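(* Let $G$ and $H$ be disjoint graphs, and let $\mathcal{P} = \{V_1, \ldots, V_r\}$ and $\mathcal{Q} = \{W_1, \ldots, W_s\}$ be partitions of $V(G)$ and $V(H)$, respectively. Let $\mathcal{R} = \{V_1', \ldots, V_r', W_1, \ldots, W_{s-1}\}$, where $V_1' \supseteq V_1, \ldots, V_r' \supseteq V_r$ are obtained by distributing each of the vertices of $W_s$ into one of $V_1, \ldots, V_r$ arbitrarily (each vertex of $W_s$ is placed in exactly one of the $V_i'$). If $G$ has no independent transversal with respect to $\mathcal{P}$ and $H$ has no independent transversal with respect to $\mathcal{Q}$, then $G \cup H$ has no independent transversal with respect to $\mathcal{R}$.
   Context: Graphs are finite and simple. For a graph $G$ and a partition $\mathcal{P} = \{V_1, \ldots, V_r\}$ of $V(G)$ into blocks (nonempty classes), an independent transversal (IT) of $G$ with respect to $\mathcal{P}$ is an independent set $\{v_1, \ldots, v_r\}$ of $G$ with $v_i \in V_i$ for every $i \in \{1,\ldots,r\}$. For disjoint graphs $G,H$, $G\cup H$ is their disjoint union (no edges between $V(G)$ and $V(H)$). *)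

theory Defs
  imports "Graph_Theory.Digraph_Component" "HOL-Library.Disjoint_Sets" "HOL-Library.FuncSet"
begin

text \<open>
  A finite simple graph is a \<open>pair_graph\<close>: a finite loop-free digraph with symmetric arc relation,
  where \<open>{u, v}\<close> is an edge iff \<open>(u, v)\<close> and \<open>(v, u)\<close> are arcs. Graphs on disjoint vertex sets of
  one ambient type are combined by the library's \<open>union\<close>, which yields a \<open>pre_digraph\<close>. The notions
  below are therefore stated for \<open>pre_digraph\<close>; a \<open>pair_pre_digraph\<close> is coerced by \<open>with_proj\<close>.
\<close>

definition independent_set :: "('a, 'b) pre_digraph \<Rightarrow> 'a set \<Rightarrow> bool" where
  "independent_set G S \<longleftrightarrow> S \<subseteq> verts G \<and> (\<forall>u\<in>S. \<forall>v\<in>S. (u, v) \<notin> arcs_ends G)"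

definition independent_transversal ::
    "('a, 'b) pre_digraph \<Rightarrow> 'a set set \<Rightarrow> 'a set \<Rightarrow> bool" where
  "independent_transversal G P S \<longleftrightarrow>
     independent_set G S \<and> (\<exists>v. (\<forall>B\<in>P. v B \<in> B) \<and> S = v ` P)"

definition has_independent_transversal :: "('a, 'b) pre_digraph \<Rightarrow> 'a set set \<Rightarrow> bool" where
  "has_independent_transversal G P \<longleftrightarrow> (\<exists>S. independent_transversal G P S)"

text \<open>
  The blocks \<open>V' 1, \<dots>, V' r\<close> arise from \<open>V 1, \<dots>, V r\<close> by placing each \<open>x \<in> X\<close> into the block with
  index \<open>d x\<close>.
\<close>

definition distributed ::
    "'a set \<Rightarrow> nat \<Rightarrow> (nat \<Rightarrow> 'a set) \<Rightarrow> (nat \<Rightarrow> 'a set) \<Rightarrow> bool" where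
  "distributed X r V V' \<longleftrightarrow>
     (\<exists>d \<in> X \<rightarrow> {1..r}. \<forall>i\<in>{1..r}. V' i = V i \<union> {x \<in> X. d x = i})"

end

theory Submission
  imports Defs
begin

text \<open>
  Take a transversal of \<open>G \<union> H\<close>. If each of its vertices in a block \<open>V' i\<close> lies in \<open>V i\<close>, these
  vertices form a transversal of \<open>G\<close>. Otherwise one of them lies in \<open>W s\<close>, and together with the
  vertices chosen in \<open>W 1, \<dots>, W (s - 1)\<close> it forms a transversal of \<open>H\<close>.
\<close>

text \<open>Injectivity of \<open>V\<close> recovers the index from the block, so a choice
  \<open>f\<close> indexed by \<open>I\<close> turns into a choice function on the blocks
  themselves, as \<open>independent_transversal\<close> demands.\<close>

lemma has_independent_transversal_imageI:
  assumes "inj_on V I" and "\<And>i. i \<in> I \<Longrightarrow> f i \<in> V i" and "independent_set G (f ` I)"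
  shows "has_independent_transversal G (V ` I)"
proof -
  define v where "v = f \<circ> the_inv_into I V"
  have v: "v (V i) = f i" if "i \<in> I" for i
    using assms(1) that by (simp add: v_def the_inv_into_f_f)
  then have "\<forall>B\<in>V ` I. v B \<in> B" and "f ` I = v ` V ` I"
    using assms(2) by (auto simp: image_image cong: image_cong)
  with assms(3) show ?thesis
    unfolding has_independent_transversal_def independent_transversal_def by blast
qed

lemma arcs_ends_with_proj: "arcs_ends (with_proj G) = parcs G"
  by (auto simp: arcs_ends_def arc_to_ends_def)

text \<open>Both graphs have \<open>fst\<close> and \<open>snd\<close> as end maps, so the end maps
  of the union are correct for the arcs of either graph.\<close>

lemma arcs_ends_union_with_proj:
  "arcs_ends (union (with_proj G) (with_proj H)) = parcs G \<union> parcs H"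
  by (auto simp: arcs_ends_def arc_to_ends_def)

theorem lemma3:
  fixes G H :: "'a pair_pre_digraph"
    and V V' W :: "nat \<Rightarrow> 'a set"
    and r s :: nat
  assumes "pair_graph G" and "pair_graph H"
    and "pverts G \<inter> pverts H = {}"
    and "partition_on (pverts G) (V ` {1..r})" and "inj_on V {1..r}"
    and "partition_on (pverts H) (W ` {1..s})" and "inj_on W {1..s}"
    and "1 \<le> s"
    and "distributed (W s) r V V'"
    and "\<not> has_independent_transversal (with_proj G) (V ` {1..r})"
    and "\<not> has_independent_transversal (with_proj H) (W ` {1..s})"
  shows "\<not> has_independent_transversal (union (with_proj G) (with_proj H))
           (V' ` {1..r} \<union> W ` {1..<s})"
proof
  assume "has_independent_transversal (union (with_proj G) (with_proj H))
    (V' ` {1..r} \<union> W ` {1..<s})"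
  then obtain v where v: "\<forall>B\<in>V' ` {1..r} \<union> W ` {1..<s}. v B \<in> B"
    and indep: "independent_set (union (with_proj G) (with_proj H))
      (v ` (V' ` {1..r} \<union> W ` {1..<s}))"
    unfolding has_independent_transversal_def independent_transversal_def by metis
  \<comment> \<open>Independence is restated in terms of blocks, so that either case can apply it to
    its own subfamily of the chosen vertices.\<close>
  have no_arc: "(v A, v B) \<notin> parcs G \<union> parcs H"
    if "A \<in> V' ` {1..r} \<union> W ` {1..<s}" and "B \<in> V' ` {1..r} \<union> W ` {1..<s}" for A B
  proof -
    have "v A \<in> v ` (V' ` {1..r} \<union> W ` {1..<s})" "v B \<in> v ` (V' ` {1..r} \<union> W ` {1..<s})"
      by (intro imageI that)+
    with indep show ?thesis
      unfolding independent_set_def arcs_ends_union_with_proj by metis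
  qed
  have VG: "V i \<subseteq> pverts G" if "i \<in> {1..r}" for i
    using partition_onD1[OF assms(4)] that by blast
  have WH: "W j \<subseteq> pverts H" if "j \<in> {1..s}" for j
    using partition_onD1[OF assms(6)] that by blast
  show False
  proof (cases "\<forall>i\<in>{1..r}. v (V' i) \<in> V i")
    case True
    have "(\<lambda>i. v (V' i)) ` {1..r} \<subseteq> pverts G"
      using True VG by blast
    moreover have "(v (V' i), v (V' j)) \<notin> parcs G" if "i \<in> {1..r}" "j \<in> {1..r}" for i j
      using no_arc[of "V' i" "V' j"] that by simp
    ultimately have "independent_set (with_proj G) ((\<lambda>i. v (V' i)) ` {1..r})"
      unfolding independent_set_def arcs_ends_with_proj by simp
    then have "has_independent_transversal (with_proj G) (V ` {1..r})"
      using True has_independent_transversal_imageI[OF assms(5), of "\<lambda>i. v (V' i)"] by simp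
    with assms(10) show False by contradiction
  next
    case False
    then obtain i where i: "i \<in> {1..r}" "v (V' i) \<notin> V i"
      by blast
    moreover have "v (V' i) \<in> V' i"
      using i(1) v by simp
    \<comment> \<open>The only vertices that \<open>V' i\<close> has beyond \<open>V i\<close> were
      distributed from \<open>W s\<close>.\<close>
    ultimately have vi: "v (V' i) \<in> W s"
      using assms(9) unfolding distributed_def by auto
    \<comment> \<open>\<open>c j\<close> is the block of the combined family whose chosen vertex
      represents \<open>W j\<close>. As \<open>v\<close> is only known to choose properly from
      \<open>W j\<close> for \<open>j < s\<close>, the representative of \<open>W s\<close> is taken
      from \<open>V' i\<close>.\<close>
    define c where "c j = (if j = s then V' i else W j)" for j
    have c: "c j \<in> V' ` {1..r} \<union> W ` {1..<s}" and vc: "v (c j) \<in> W j" if "j \<in> {1..s}" for j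
    proof -
      have "j = s \<or> j \<in> {1..<s}"
        using that by auto
      then show "c j \<in> V' ` {1..r} \<union> W ` {1..<s}" and "v (c j) \<in> W j"
        using i(1) vi v by (auto simp: c_def)
    qed
    have "(\<lambda>j. v (c j)) ` {1..s} \<subseteq> pverts H"
      using vc WH by blast
    moreover have "(v (c j), v (c k)) \<notin> parcs H" if "j \<in> {1..s}" "k \<in> {1..s}" for j k
      using no_arc[OF c c, of j k] that by simp
    ultimately have "independent_set (with_proj H) ((\<lambda>j. v (c j)) ` {1..s})"
      unfolding independent_set_def arcs_ends_with_proj by simp
    then have "has_independent_transversal (with_proj H) (W ` {1..s})"
      using vc has_independent_transversal_imageI[OF assms(7), of "\<lambda>j. v (c j)"] by simp
    with assms(11) show False by contradiction
  qed
qed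

end
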